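(* Let $(S_n)_{n\ge1}$ be a sequence of $2\times2$ stochastic matrices, $S_n=\begin{pmatrix} x_n & 1-x_n \\ y_n & 1-y_n \end{pmatrix}$ with $x_n,y_n\in[0,1]$. Put $Q_0=I$, $Q_n=S_nS_{n-1}\cdots S_1$ (left-product) and $P_n=S_1S_2\cdots S_n$ (right-product) for $n\ge1$. (i) The sequence $(Q_n)$ converges if and only if $\prod_{k=1}^n(x_k-y_k)$ has limit $0$ as $n\to+\infty$ or $(x_n,y_n)$ has limit $(1,0)$ as $n\to+\infty$. (ii) The sequence $(Q_n)$ diverges only in the case where $\sum_n(1-|x_n-y_n|)$ converges and $S_n$ does not tend to $\begin{pmatrix}1&0\\ 0&1\end{pmatrix}$. (iii) If $(Q_n)$ converges, then $\lim_{n\to\infty}Q_n=\begin{pmatrix} s+q & 1-s-q \\ s & 1-s \end{pmatrix}$, where $s:=\sum_{n\ge1}y_n\det Q_{n-1}$ and $q:=\lim_{n\to\infty}\det Q_n$. (iv) Suppose that the $S_n$ belong to a finite set. Then $(P_n)$ converges if and only if there exists an integer $n_0\ge1$ such that the matrices $S_n$ for $n\ge n_0$ have a common left-eigenvector $L$ for the eigenvalue $1$, and either $\lim_{n\to\infty}\prod_{k=n_0}^n(x_k-y_k)=0$, or $\lim_{n\to\infty}(x_n,y_n)=(1,0)$, or the rows of $S_1\cdots S_{n_0-1}$ are colinear to $L$. (v) Suppose that the $S_n$, $n\ge1$, have a common left-eigenvector for the eigenvalue $1$. Then the $S_n$ commute and $P_n=Q_n$ for every $n$.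
   Context: A square matrix is stochastic if its entries are nonnegative and each of its rows sums to $1$. A left-eigenvector of $S$ for the eigenvalue $1$ is a nonzero row vector $L$ with $LS=L$. Convergence of matrices is entrywise, and "diverges" means "does not converge". The empty product $S_1\cdots S_{n_0-1}$ for $n_0=1$ is the identity matrix. *)

theory Defs
  imports "HOL-Analysis.Analysis"
begin

definition stochastic :: "real^'n^'n \<Rightarrow> bool" where
  "stochastic A \<longleftrightarrow> (\<forall>i j. 0 \<le> A $ i $ j) \<and> (\<forall>i. (\<Sum>j\<in>UNIV. A $ i $ j) = 1)"

definition left_eigenvector_1 :: "real^'n \<Rightarrow> real^'n^'n \<Rightarrow> bool" where
  "left_eigenvector_1 L A \<longleftrightarrow> L \<noteq> 0 \<and> L v* A = L"

(* Sequences of matrices are indexed from 1: the value S 0 is never used in the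
   products below, and the empty products are the identity. *)

primrec left_product :: "(nat \<Rightarrow> real^'n^'n) \<Rightarrow> nat \<Rightarrow> real^'n^'n" where
  "left_product S 0 = mat 1"
| "left_product S (Suc n) = S (Suc n) ** left_product S n"

primrec right_product :: "(nat \<Rightarrow> real^'n^'n) \<Rightarrow> nat \<Rightarrow> real^'n^'n" where
  "right_product S 0 = mat 1"
| "right_product S (Suc n) = right_product S n ** S (Suc n)"

(* Two vectors are colinear when they lie on a common line through the origin. *)

definition rows_colinear_to :: "real^'n^'n \<Rightarrow> real^'n \<Rightarrow> bool" where
  "rows_colinear_to A L \<longleftrightarrow> (\<forall>i. collinear {0, L, row i A})"

end

theory Submission
  imports Defs
begin

text \<open>
A stochastic $2 \times 2$ matrix is given by its first column $(x, y)$, and its determinant is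
$x - y \in [-1, 1]$; it maps a row $(p, 1 - p)$ to the row with first entry $y + p (x - y)$.
Everything therefore happens on scalars.

Left products. The matrix $Q_n$ has the first column $(b_n + D_n, b_n)$ with
$D_n = \det Q_n = \prod_{k \le n} (x_k - y_k)$ and $b_n = \sum_{k \le n} y_k D_{k-1}$, so only
the convergence of $b_n$ and $D_n$ matters; the formula for the limit can be read off. Both entries of
the new first column are averages of the two old ones, so the intervals that they span are nested
and their lower ends $b_n + \min(D_n, 0)$ always converge. Hence $Q_n$ converges as soon as $D_n$
does (\<open>convergent_left_product_iff_D\<close>). Finally $D_n$ converges to a nonzero limit only if its
last factor $x_n - y_n$ tends to $1$, which for $x_n \le 1$ and $y_n \ge 0$ means
$(x_n, y_n) \to (1, 0)$; conversely a product of numbers in $[-1, 1]$ that tend to $1$ converges,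
its tail being decreasing (\<open>convergent_prod_if_tendsto_1\<close>). When $Q_n$ diverges, $|D_n|$
decreases to a positive number, and since $|D_{k-1}| (1 - |x_k - y_k|) = |D_{k-1}| - |D_k|$
telescopes, the sum of the $1 - |x_k - y_k|$ is finite.

Right products. If $P_n \to P$ and $S_n$ takes finitely many values, then from some $n_0$ on only
values $M$ occur that are taken infinitely often, and passing to the limit in $P_n = P_{n-1} M$ gives
$P M = P$ (\<open>right_product_limit_fixed\<close>): the rows of $P$ are common left-eigenvectors. If $l$
is the first entry of a common stationary row, the corresponding entry $p_n$ of a row of $P_n$ obeys
$p_n - l = (x_n - y_n) (p_{n-1} - l)$, so that $p_n - l$ is $p_{n_0 - 1} - l$ times the product of
the factors from $n_0$ to $n$ (\<open>orbit_minus_stationary\<close>). This identity decides both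
directions of the criterion. Stationarity with respect to $L$ is the linear equation
$L_1 (1 - x) = L_2 y$; two matrices that satisfy it have proportional vectors $(1 - x, y)$, which is
exactly the condition for them to commute.
\<close>

section \<open>Stochastic matrices of order two\<close>

definition two_state :: "real \<Rightarrow> real \<Rightarrow> real^2^2" where
  "two_state p r = vector [vector [p, 1 - p], vector [r, 1 - r]]"

lemma two_state_nth [simp]:
  "two_state p r $ 1 $ 1 = p" "two_state p r $ 1 $ 2 = 1 - p"
  "two_state p r $ 2 $ 1 = r" "two_state p r $ 2 $ 2 = 1 - r"
  by (simp_all add: two_state_def)

lemma two_state_eq_iff [simp]: "two_state p r = two_state p' r' \<longleftrightarrow> p = p' \<and> r = r'"
  by (metis two_state_nth(1,3))

lemma mat_1_eq_two_state: "mat 1 = two_state 1 0"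
  by (simp add: vec_eq_iff forall_2 mat_def)

lemma det_two_state: "det (two_state p r) = p - r"
  by (simp add: det_2 algebra_simps)

lemma two_state_mult:
  "two_state p r ** two_state u v = two_state (v + p * (u - v)) (v + r * (u - v))"
  by (simp add: vec_eq_iff forall_2 matrix_matrix_mult_def sum_2 algebra_simps)

lemma tendsto_two_state_iff:
  "((\<lambda>n. two_state (p n) (r n)) \<longlongrightarrow> two_state p' r') F \<longleftrightarrow>
     (p \<longlongrightarrow> p') F \<and> (r \<longlongrightarrow> r') F" (is "?lhs \<longleftrightarrow> ?rhs")
proof
  assume ?lhs
  then have "((\<lambda>n. two_state (p n) (r n) $ i $ 1) \<longlongrightarrow> two_state p' r' $ i $ 1) F" for i
    by (intro tendsto_vec_nth)
  from this[of 1] this[of 2] show ?rhs by simp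
next
  assume rhs: ?rhs
  have "((\<lambda>n. two_state (p n) (r n) $ i $ j) \<longlongrightarrow> two_state p' r' $ i $ j) F" for i j :: 2
    using rhs exhaust_2[of i] exhaust_2[of j] by (auto intro!: tendsto_diff tendsto_const)
  then show ?lhs by (intro vec_tendstoI)
qed

lemma convergent_two_state_iff:
  "convergent (\<lambda>n. two_state (p n) (r n)) \<longleftrightarrow> convergent p \<and> convergent r" (is "?lhs \<longleftrightarrow> ?rhs")
proof
  assume ?lhs
  then obtain A where A: "(\<lambda>n. two_state (p n) (r n)) \<longlonglongrightarrow> A" by (auto simp: convergent_def)
  have "(\<lambda>n. two_state (p n) (r n) $ i $ 1) \<longlonglongrightarrow> A $ i $ 1" for i
    using A by (intro tendsto_vec_nth)
  from this[of 1] this[of 2] show ?rhs by (simp add: convergentI)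
next
  assume ?rhs
  then obtain p' r' where "p \<longlonglongrightarrow> p'" "r \<longlonglongrightarrow> r'" by (auto simp: convergent_def)
  then have "(\<lambda>n. two_state (p n) (r n)) \<longlonglongrightarrow> two_state p' r'"
    by (simp add: tendsto_two_state_iff)
  then show ?lhs by (rule convergentI)
qed

lemma left_eigenvector_two_state_iff:
  "left_eigenvector_1 L (two_state p r) \<longleftrightarrow> L \<noteq> 0 \<and> L $ 1 * (1 - p) = L $ 2 * r"
  by (auto simp: left_eigenvector_1_def vec_eq_iff forall_2 vector_matrix_mult_def sum_2
      algebra_simps)

text \<open>The rows have entry sum $1$, so the only multiple of \<open>L\<close> that can be such a row is
\<open>L\<close> divided by its own entry sum. A nonzero vector with entry sum $0$
has no such multiple.\<close>

lemma rows_colinear_two_state_iff: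
  assumes "L $ 1 + L $ 2 = s" and "s \<noteq> 0"
  shows "rows_colinear_to (two_state p r) L \<longleftrightarrow> p = L $ 1 / s \<and> r = L $ 1 / s"
proof -
  have nz: "L \<noteq> 0" using assms by auto
  have "collinear {0, L, row i (two_state p r)} \<longleftrightarrow> two_state p r $ i $ 1 = L $ 1 / s"
    (is "?l \<longleftrightarrow> ?r") for i
  proof -
    have sum1: "two_state p r $ i $ 2 = 1 - two_state p r $ i $ 1"
      using exhaust_2[of i] by auto
    have "?l \<longleftrightarrow> (\<exists>c. row i (two_state p r) = c *\<^sub>R L)"
      using nz by (auto simp: collinear_lemma intro: exI[of _ 0])
    also have "\<dots> \<longleftrightarrow> (\<exists>c. two_state p r $ i $ 1 = c * L $ 1 \<and> two_state p r $ i $ 2 = c * L $ 2)"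
      by (simp add: vec_eq_iff forall_2 row_def)
    also have "\<dots> \<longleftrightarrow> ?r"
    proof
      assume "\<exists>c. two_state p r $ i $ 1 = c * L $ 1 \<and> two_state p r $ i $ 2 = c * L $ 2"
      then obtain c where c: "two_state p r $ i $ 1 = c * L $ 1" "two_state p r $ i $ 2 = c * L $ 2"
        by blast
      have "c * s = 1" using c sum1 assms(1) by (metis add_diff_cancel_left' diff_add_cancel distrib_left add.commute)
      then show ?r using c assms by (simp add: field_simps)
    next
      assume ?r
      moreover have "1 - L $ 1 / s = L $ 2 / s"
        using assms by (simp add: field_simps)
      ultimately show "\<exists>c. two_state p r $ i $ 1 = c * L $ 1 \<and> two_state p r $ i $ 2 = c * L $ 2"
        using sum1 by (intro exI[of _ "1 / s"]) simp
    qed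
    finally show ?thesis .
  qed
  then show ?thesis by (simp add: rows_colinear_to_def forall_2)
qed

section \<open>Products of factors tending to one\<close>

lemma convergent_prod_if_tendsto_1:
  fixes d :: "nat \<Rightarrow> real"
  assumes "\<And>n. n \<ge> m \<Longrightarrow> d n \<le> 1" and lim: "d \<longlonglongrightarrow> 1"
  shows "convergent (\<lambda>n. \<Prod>k=m..n. d k)"
proof -
  \<comment> \<open>From some index \<open>N\<close> on the factors lie in $(0, 1]$, and the tail product is decreasing;
    the finitely many factors before \<open>N\<close> are a constant.\<close>
  have "\<forall>\<^sub>F n in sequentially. 0 < d n"
    using order_tendstoD(1)[OF lim, of 0] by simp
  then obtain N where N: "\<And>n. n \<ge> N \<Longrightarrow> 0 < d n" "N \<ge> m"
    unfolding eventually_sequentially by (meson linorder_le_cases order_trans)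
  have tail_pos: "(\<Prod>k=N..n. d k) \<ge> 0" for n
    using N by (intro prod_nonneg) (auto simp: less_imp_le)
  have "decseq (\<lambda>n. \<Prod>k=N..n. d k)"
  proof (rule decseq_SucI)
    fix n
    show "(\<Prod>k=N..Suc n. d k) \<le> (\<Prod>k=N..n. d k)"
    proof (cases "N \<le> Suc n")
      case True
      then have "d (Suc n) \<le> 1" using assms(1)[of "Suc n"] N(2) by simp
      then show ?thesis using True mult_left_le[OF _ tail_pos, of "d (Suc n)" n] by simp
    qed simp
  qed
  then have "convergent (\<lambda>n. \<Prod>k=N..n. d k)"
    using tail_pos decseq_convergent unfolding convergent_def by metis
  then have "convergent (\<lambda>n. (\<Prod>k=m..<N. d k) * (\<Prod>k=N..n. d k))"
    by (intro convergent_mult convergent_const)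
  moreover have split: "\<forall>\<^sub>F n in sequentially.
      (\<Prod>k=m..n. d k) = (\<Prod>k=m..<N. d k) * (\<Prod>k=N..n. d k)"
    using eventually_ge_at_top[of N]
  proof eventually_elim
    case (elim n)
    then have "{m..n} = {m..<N} \<union> {N..n}" "{m..<N} \<inter> {N..n} = {}"
      using N(2) by auto
    then show ?case by (simp add: prod.union_disjoint)
  qed
  ultimately show ?thesis by (simp only: convergent_cong[OF split])
qed

section \<open>Limits of right products over a finite set of matrices\<close>

lemma matrix_mult_tendsto:
  fixes A :: "'b \<Rightarrow> real^'n^'m" and M :: "real^'k^'n"
  assumes "(A \<longlongrightarrow> B) F"
  shows "((\<lambda>n. A n ** M) \<longlongrightarrow> B ** M) F"
  unfolding matrix_matrix_mult_def
  by (intro vec_tendstoI) (auto intro!: tendsto_intros assms)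

text \<open>A matrix \<open>M\<close> that occurs infinitely often satisfies \<open>P ** M = P\<close>, because
\<open>right_product S n ** M\<close>, which tends to \<open>P ** M\<close>, coincides infinitely often with the
next product, which tends to \<open>P\<close>.
Finiteness of the set of values gives one index after which no other matrices occur.\<close>

lemma right_product_limit_fixed:
  fixes S :: "nat \<Rightarrow> real^'n^'n"
  assumes "finite (S ` {1..})" and lim: "right_product S \<longlonglongrightarrow> P"
  shows "\<exists>n0\<ge>1. \<forall>n\<ge>n0. P ** S n = P"
proof -
  have fixed: "P ** M = P" if inf: "\<exists>\<^sub>\<infinity>n. S (Suc n) = M" for M
  proof (rule ccontr)
    assume ne: "P ** M \<noteq> P"
    have "(\<lambda>n. right_product S n ** M - right_product S (Suc n)) \<longlonglongrightarrow> P ** M - P"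
      by (intro tendsto_diff matrix_mult_tendsto lim LIMSEQ_Suc)
    then have "\<forall>\<^sub>F n in sequentially. right_product S n ** M - right_product S (Suc n) \<noteq> 0"
      using ne by (intro tendsto_imp_eventually_ne) auto
    then have "\<forall>\<^sub>F n in sequentially. S (Suc n) \<noteq> M"
      by eventually_elim auto
    with inf show False
      by (simp add: frequently_def cofinite_eq_sequentially)
  qed
  have "\<forall>M\<in>S ` {1..}. P ** M \<noteq> P \<longrightarrow> (\<forall>\<^sub>F n in sequentially. S (Suc n) \<noteq> M)"
    using fixed by (auto simp: frequently_def cofinite_eq_sequentially)
  then have "\<forall>\<^sub>F n in sequentially. \<forall>M\<in>S ` {1..}. P ** M \<noteq> P \<longrightarrow> S (Suc n) \<noteq> M"
    by (intro eventually_ball_finite assms(1)) (auto simp: eventually_conj_iff elim: eventually_mono)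
  then obtain N where N: "\<And>n. n \<ge> N \<Longrightarrow> P ** S (Suc n) = P"
    unfolding eventually_sequentially by fastforce
  have "P ** S n = P" if "n \<ge> Suc N" for n
    using N[of "n - 1"] that by simp
  then show ?thesis by (intro exI[of _ "Suc N"]) simp
qed

section \<open>The action on a single row\<close>

text \<open>First entry of the row $(p, 1 - p)\, S_1 \cdots S_n$. The starting values \<open>1\<close> and
\<open>0\<close> give the two rows of the right product.\<close>

primrec orbit :: "(nat \<Rightarrow> real) \<Rightarrow> (nat \<Rightarrow> real) \<Rightarrow> real \<Rightarrow> nat \<Rightarrow> real" where
  "orbit x y p 0 = p"
| "orbit x y p (Suc n) = y (Suc n) + orbit x y p n * (x (Suc n) - y (Suc n))"

text \<open>A stationary row turns the affine recursion into a linear one: the deviation from \<open>l\<close> is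
multiplied by the determinant at each step.\<close>

lemma orbit_minus_stationary:
  assumes stat: "\<And>k. k \<ge> m \<Longrightarrow> y k + l * (x k - y k) = l" and "1 \<le> m" "m \<le> Suc n"
  shows "orbit x y p n - l = (\<Prod>k=m..n. (x k - y k)) * (orbit x y p (m - 1) - l)"
proof -
  have "m - 1 \<le> n" using \<open>m \<le> Suc n\<close> by simp
  then show ?thesis
  proof (induction rule: dec_induct)
    case base
    then show ?case using \<open>1 \<le> m\<close> by simp
  next
    case (step k)
    then have "m \<le> Suc k" by simp
    have "orbit x y p (Suc k) - l = (x (Suc k) - y (Suc k)) * (orbit x y p k - l)"
      using stat[OF \<open>m \<le> Suc k\<close>] by (simp add: algebra_simps)
    then show ?case using step.IH \<open>m \<le> Suc k\<close> by simp
  qed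
qed

section \<open>Left products\<close>

locale two_state_sequence =
  fixes S :: "nat \<Rightarrow> real^2^2" and x y :: "nat \<Rightarrow> real"
  assumes S_eq: "\<And>n. n \<ge> 1 \<Longrightarrow> S n = two_state (x n) (y n)"
    and range: "\<And>n. n \<ge> 1 \<Longrightarrow> x n \<in> {0..1} \<and> y n \<in> {0..1}"
begin

definition D :: "nat \<Rightarrow> real" where "D n = (\<Prod>k=1..n. (x k - y k))"

definition b :: "nat \<Rightarrow> real" where "b n = (\<Sum>k<n. y (Suc k) * D k)"

text \<open>\<open>D n\<close> is the determinant of the left product and \<open>b n\<close> its lower left entry, by the
two lemmas \<open>det_left_product\<close> and \<open>left_product_eq\<close>.\<close>

lemma D_simps [simp]: "D 0 = 1" "D (Suc n) = D n * (x (Suc n) - y (Suc n))"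
  by (simp_all add: D_def)

lemma b_simps [simp]: "b 0 = 0" "b (Suc n) = b n + y (Suc n) * D n"
  by (simp_all add: b_def)

lemma left_product_eq: "left_product S n = two_state (b n + D n) (b n)"
  by (induction n) (simp_all add: mat_1_eq_two_state S_eq two_state_mult algebra_simps)

lemma det_left_product: "det (left_product S n) = D n"
  by (simp add: left_product_eq det_two_state)

lemma right_product_eq: "right_product S n = two_state (orbit x y 1 n) (orbit x y 0 n)"
  by (induction n) (simp_all add: mat_1_eq_two_state S_eq two_state_mult)

text \<open>The first column of the left product is $(b_n + D_n, b_n)$, so \<open>b n + min (D n) 0\<close> is its
minimum. Multiplying by a stochastic matrix from the left replaces both entries by averages of them
and cannot lower the minimum.\<close>

lemma incseq_lower: "incseq (\<lambda>n. b n + min (D n) 0)"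
proof (rule incseq_SucI)
  fix n
  have r: "x (Suc n) \<in> {0..1}" "y (Suc n) \<in> {0..1}" using range[of "Suc n"] by auto
  have D_Suc: "D (Suc n) = x (Suc n) * D n - y (Suc n) * D n" by (simp add: algebra_simps)
  have average: "min (D n) 0 \<le> t * D n" if "t \<in> {0..1}" for t
    using that mult_left_le_one_le[of "- D n" t] by (cases "D n \<ge> 0") auto
  show "b n + min (D n) 0 \<le> b (Suc n) + min (D (Suc n)) 0"
    using average[OF r(1)] average[OF r(2)] D_Suc b_simps(2)[of n] by linarith
qed

lemma decseq_upper: "decseq (\<lambda>n. b n + max (D n) 0)"
proof (rule decseq_SucI)
  fix n
  have r: "x (Suc n) \<in> {0..1}" "y (Suc n) \<in> {0..1}" using range[of "Suc n"] by auto
  have D_Suc: "D (Suc n) = x (Suc n) * D n - y (Suc n) * D n" by (simp add: algebra_simps)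
  have average: "t * D n \<le> max (D n) 0" if "t \<in> {0..1}" for t
    using that mult_left_le_one_le[of "D n" t] by (cases "D n \<ge> 0") (auto simp: mult_nonneg_nonpos)
  show "b (Suc n) + max (D (Suc n)) 0 \<le> b n + max (D n) 0"
    using average[OF r(1)] average[OF r(2)] D_Suc b_simps(2)[of n] by linarith
qed

lemma convergent_lower: "convergent (\<lambda>n. b n + min (D n) 0)"
proof -
  have "b n + min (D n) 0 \<le> 1" for n
    using decseqD[OF decseq_upper, of 0 n] by simp
  then show ?thesis
    using incseq_convergent[OF incseq_lower] unfolding convergent_def by metis
qed

lemma convergent_left_product_iff_entries:
  "convergent (left_product S) \<longleftrightarrow> convergent (\<lambda>n. b n + D n) \<and> convergent b"
proof -
  have "left_product S = (\<lambda>n. two_state (b n + D n) (b n))"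
    by (rule ext) (rule left_product_eq)
  then show ?thesis by (simp only: convergent_two_state_iff)
qed

lemma convergent_right_product_iff_entries:
  "convergent (right_product S) \<longleftrightarrow> convergent (orbit x y 1) \<and> convergent (orbit x y 0)"
proof -
  have "right_product S = (\<lambda>n. two_state (orbit x y 1 n) (orbit x y 0 n))"
    by (rule ext) (rule right_product_eq)
  then show ?thesis by (simp only: convergent_two_state_iff)
qed

text \<open>For the nontrivial direction, \<open>b\<close> is the difference of the lower end of the nested
intervals, which always converges, and of \<open>min (D n) 0\<close>, which converges with \<open>D\<close>.\<close>

lemma convergent_left_product_iff_D: "convergent (left_product S) \<longleftrightarrow> convergent D"
proof
  assume "convergent (left_product S)"
  then have "convergent (\<lambda>n. b n + D n)" "convergent b"
    unfolding convergent_left_product_iff_entries by auto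
  then have "convergent (\<lambda>n. (b n + D n) - b n)" by (rule convergent_diff)
  then show "convergent D" by simp
next
  assume D: "convergent D"
  then obtain q where "D \<longlonglongrightarrow> q" by (auto simp: convergent_def)
  then have "(\<lambda>n. min (D n) 0) \<longlonglongrightarrow> min q 0" by (intro tendsto_min tendsto_const)
  then have "convergent (\<lambda>n. min (D n) 0)" by (rule convergentI)
  with convergent_lower have "convergent (\<lambda>n. (b n + min (D n) 0) - min (D n) 0)"
    by (rule convergent_diff)
  then have "convergent b" by simp
  moreover from this D have "convergent (\<lambda>n. b n + D n)" by (rule convergent_add)
  ultimately show "convergent (left_product S)"
    unfolding convergent_left_product_iff_entries by blast
qed

text \<open>The point $(1, 0)$ is the only one of the unit square where $x - y$ reaches its maximum $1$.\<close>

lemma factor_tendsto_1_iff: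
  "(\<lambda>n. x n - y n) \<longlonglongrightarrow> 1 \<longleftrightarrow> (\<lambda>n. (x n, y n)) \<longlonglongrightarrow> (1, 0)"
proof
  assume lim: "(\<lambda>n. x n - y n) \<longlonglongrightarrow> 1"
  have ev: "\<forall>\<^sub>F n in sequentially. x n - y n \<le> x n \<and> x n \<le> 1"
    using eventually_ge_at_top[of 1] by eventually_elim (use range in auto)
  have x: "x \<longlonglongrightarrow> 1"
    by (rule tendsto_sandwich[OF _ _ lim tendsto_const]) (use ev in \<open>auto elim: eventually_mono\<close>)
  have "y \<longlonglongrightarrow> 0" using tendsto_diff[OF x lim] by simp
  with x show "(\<lambda>n. (x n, y n)) \<longlonglongrightarrow> (1, 0)" by (rule tendsto_Pair)
next
  assume "(\<lambda>n. (x n, y n)) \<longlonglongrightarrow> (1, 0)"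
  from tendsto_fst[OF this] tendsto_snd[OF this]
  have "(\<lambda>n. x n - y n) \<longlonglongrightarrow> 1 - 0" by (intro tendsto_diff) simp_all
  then show "(\<lambda>n. x n - y n) \<longlonglongrightarrow> 1" by simp
qed

text \<open>If the product has a nonzero limit, its factors, as quotients of consecutive terms, tend to $1$.\<close>

lemma convergent_D_iff: "convergent D \<longleftrightarrow> D \<longlonglongrightarrow> 0 \<or> (\<lambda>n. x n - y n) \<longlonglongrightarrow> 1"
proof
  assume "convergent D"
  then obtain q where q: "D \<longlonglongrightarrow> q" by (auto simp: convergent_def)
  show "D \<longlonglongrightarrow> 0 \<or> (\<lambda>n. x n - y n) \<longlonglongrightarrow> 1"
  proof (cases "q = 0")
    case False
    have "(\<lambda>n. D (Suc n) / D n) \<longlonglongrightarrow> q / q"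
      by (intro tendsto_divide LIMSEQ_Suc q False)
    moreover have "\<forall>\<^sub>F n in sequentially. D (Suc n) / D n = x (Suc n) - y (Suc n)"
      using tendsto_imp_eventually_ne[OF q False] by eventually_elim simp
    ultimately have "(\<lambda>n. x (Suc n) - y (Suc n)) \<longlonglongrightarrow> q / q"
      by (rule Lim_transform_eventually)
    then have "(\<lambda>n. x (Suc n) - y (Suc n)) \<longlonglongrightarrow> 1" using False by simp
    then have "(\<lambda>n. x n - y n) \<longlonglongrightarrow> 1" by (rule LIMSEQ_imp_Suc)
    then show ?thesis ..
  qed (use q in simp)
next
  assume "D \<longlonglongrightarrow> 0 \<or> (\<lambda>n. x n - y n) \<longlonglongrightarrow> 1"
  then show "convergent D"
  proof
    assume "(\<lambda>n. x n - y n) \<longlonglongrightarrow> 1"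
    moreover have "x n - y n \<le> 1" if "n \<ge> 1" for n using range[OF that] by auto
    ultimately show "convergent D"
      unfolding D_def[abs_def] by (intro convergent_prod_if_tendsto_1)
  qed (auto simp: convergent_def)
qed

lemma convergent_left_product_iff:
  "convergent (left_product S) \<longleftrightarrow> D \<longlonglongrightarrow> 0 \<or> (\<lambda>n. (x n, y n)) \<longlonglongrightarrow> (1, 0)"
  by (simp add: convergent_left_product_iff_D convergent_D_iff factor_tendsto_1_iff)

lemma summable_defect_if_not_D_tendsto_0:
  assumes "\<not> D \<longlonglongrightarrow> 0"
  shows "summable (\<lambda>n. 1 - \<bar>x (Suc n) - y (Suc n)\<bar>)"
proof -
  have d_le: "\<bar>x (Suc n) - y (Suc n)\<bar> \<le> 1" for n using range[of "Suc n"] by auto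
  have dec: "decseq (\<lambda>n. \<bar>D n\<bar>)"
    by (rule decseq_SucI) (simp add: abs_mult mult_left_le d_le)
  then obtain c where c: "(\<lambda>n. \<bar>D n\<bar>) \<longlonglongrightarrow> c" "\<And>n. c \<le> \<bar>D n\<bar>"
    by (rule decseq_convergent[of _ 0]) auto
  have "c \<ge> 0" by (rule LIMSEQ_le_const[OF c(1)]) simp
  moreover have "c \<noteq> 0" using c(1) assms by (auto simp: tendsto_rabs_zero_iff)
  ultimately have pos: "c > 0" by simp
  \<comment> \<open>Telescoping bounds the sum weighted by \<open>\<bar>D k\<bar>\<close>, and the weights are at least \<open>c\<close>.\<close>
  have "(\<Sum>k<n. \<bar>D k\<bar> * (1 - \<bar>x (Suc k) - y (Suc k)\<bar>)) = 1 - \<bar>D n\<bar>" for n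
  proof -
    have "\<bar>D k\<bar> * (1 - \<bar>x (Suc k) - y (Suc k)\<bar>) = \<bar>D k\<bar> - \<bar>D (Suc k)\<bar>" for k
      by (simp add: abs_mult right_diff_distrib[of "\<bar>D k\<bar>"])
    then show ?thesis using sum_lessThan_telescope'[of "\<lambda>k. \<bar>D k\<bar>" n] by simp
  qed
  then have bound: "c * (\<Sum>k<n. 1 - \<bar>x (Suc k) - y (Suc k)\<bar>) \<le> 1" for n
  proof -
    have "c * (\<Sum>k<n. 1 - \<bar>x (Suc k) - y (Suc k)\<bar>)
        \<le> (\<Sum>k<n. \<bar>D k\<bar> * (1 - \<bar>x (Suc k) - y (Suc k)\<bar>))"
      unfolding sum_distrib_left using c(2) d_le by (intro sum_mono mult_right_mono) auto
    also have "\<dots> = 1 - \<bar>D n\<bar>" by fact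
    finally show ?thesis by simp
  qed
  show ?thesis
    by (rule bounded_imp_summable[of _ "1 / c"])
      (use d_le bound[of "Suc _"] pos in \<open>auto simp: field_simps lessThan_Suc_atMost\<close>)
qed

lemma left_product_diverges:
  assumes "\<not> convergent (left_product S)"
  shows "summable (\<lambda>n. 1 - \<bar>x (Suc n) - y (Suc n)\<bar>)" and "\<not> S \<longlonglongrightarrow> two_state 1 0"
proof -
  show "summable (\<lambda>n. 1 - \<bar>x (Suc n) - y (Suc n)\<bar>)"
    using assms by (intro summable_defect_if_not_D_tendsto_0) (simp add: convergent_left_product_iff)
  have "S \<longlonglongrightarrow> two_state 1 0 \<longleftrightarrow> (\<lambda>n. two_state (x n) (y n)) \<longlonglongrightarrow> two_state 1 0"
    by (intro tendsto_cong eventually_mono[OF eventually_ge_at_top[of 1]] S_eq)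
  then show "\<not> S \<longlonglongrightarrow> two_state 1 0"
    using assms by (auto simp: convergent_left_product_iff tendsto_two_state_iff tendsto_Pair)
qed

lemma left_product_limit:
  assumes "convergent (left_product S)"
  shows "\<exists>s q. (\<lambda>n. y (Suc n) * det (left_product S n)) sums s \<and>
     (\<lambda>n. det (left_product S n)) \<longlonglongrightarrow> q \<and> left_product S \<longlonglongrightarrow> two_state (s + q) s"
proof -
  have "convergent b"
    using assms unfolding convergent_left_product_iff_entries by blast
  moreover have "convergent D" using assms by (simp add: convergent_left_product_iff_D)
  ultimately obtain s q where "b \<longlonglongrightarrow> s" "D \<longlonglongrightarrow> q" by (auto simp: convergent_def)
  moreover from this have "left_product S \<longlonglongrightarrow> two_state (s + q) s"
    by (simp add: left_product_eq[abs_def] tendsto_two_state_iff tendsto_add)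
  moreover have "(\<lambda>n. y (Suc n) * D n) sums s"
    using \<open>b \<longlonglongrightarrow> s\<close> by (simp add: sums_def b_def[abs_def])
  ultimately show ?thesis
    unfolding det_left_product by blast
qed

section \<open>Right products and common left-eigenvectors\<close>

lemma stationary_iff:
  assumes "n \<ge> 1"
  shows "left_eigenvector_1 (vector [l, 1 - l]) (S n) \<longleftrightarrow> y n + l * (x n - y n) = l"
proof -
  have "vector [l, 1 - l] \<noteq> (0 :: real^2)" by (simp add: vec_eq_iff forall_2)
  then show ?thesis using assms by (auto simp: S_eq left_eigenvector_two_state_iff algebra_simps)
qed

text \<open>The eigenvector is the first row of the limit, with first entry \<open>p\<close>; let \<open>r\<close> be that of the
second row. Both rows are stationary from \<open>n0\<close> on. If one row of the product of the first
\<open>n0 - 1\<close> matrices is not yet equal to its limit, its deviation must be driven to $0$ by the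
product of the determinants. Otherwise the rows of that product are \<open>p\<close> and \<open>r\<close>
themselves: if they agree they are colinear to the eigenvector, and if they differ, a matrix with two
different stationary rows is the identity.\<close>

lemma common_eigenvector_if_convergent_right_product:
  assumes "finite (S ` {1..})" and "convergent (right_product S)"
  shows "\<exists>n0\<ge>1. \<exists>L. (\<forall>n\<ge>n0. left_eigenvector_1 L (S n)) \<and>
             ((\<lambda>n. \<Prod>k=n0..n. (x k - y k)) \<longlonglongrightarrow> 0 \<or>
              (\<lambda>n. (x n, y n)) \<longlonglongrightarrow> (1, 0) \<or>
              rows_colinear_to (right_product S (n0 - 1)) L)"
proof -
  have "convergent (orbit x y 1)" "convergent (orbit x y 0)"
    using assms(2) unfolding convergent_right_product_iff_entries by auto
  then obtain p r where p: "orbit x y 1 \<longlonglongrightarrow> p" and r: "orbit x y 0 \<longlonglongrightarrow> r"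
    by (auto simp: convergent_def)
  then have "right_product S \<longlonglongrightarrow> two_state p r"
    by (simp add: right_product_eq[abs_def] tendsto_two_state_iff)
  with assms(1) obtain n0 where n0: "n0 \<ge> 1" "\<And>n. n \<ge> n0 \<Longrightarrow> two_state p r ** S n = two_state p r"
    using right_product_limit_fixed by blast
  have fix_p: "y n + p * (x n - y n) = p" and fix_r: "y n + r * (x n - y n) = r" if "n \<ge> n0" for n
    using n0(2)[OF that] n0(1) that by (simp_all add: S_eq two_state_mult)
  define L where "L = (vector [p, 1 - p] :: real^2)"
  have L: "\<forall>n\<ge>n0. left_eigenvector_1 L (S n)"
    unfolding L_def using stationary_iff fix_p n0(1) by auto
  have prod_0: "(\<lambda>n. \<Prod>k=n0..n. (x k - y k)) \<longlonglongrightarrow> 0"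
    if lim: "orbit x y u \<longlonglongrightarrow> l" and stat: "\<And>n. n \<ge> n0 \<Longrightarrow> y n + l * (x n - y n) = l"
      and ne: "orbit x y u (n0 - 1) \<noteq> l" for u l
  proof -
    have "(\<lambda>n. (orbit x y u n - l) / (orbit x y u (n0 - 1) - l)) \<longlonglongrightarrow>
        (l - l) / (orbit x y u (n0 - 1) - l)"
      using ne by (intro tendsto_intros lim) auto
    moreover have "\<forall>\<^sub>F n in sequentially.
        (orbit x y u n - l) / (orbit x y u (n0 - 1) - l) = (\<Prod>k=n0..n. (x k - y k))"
      using eventually_ge_at_top[of n0]
    proof eventually_elim
      case (elim n)
      then have "orbit x y u n - l = (\<Prod>k=n0..n. (x k - y k)) * (orbit x y u (n0 - 1) - l)"
        using n0(1) by (intro orbit_minus_stationary stat) auto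
      then show ?case using ne by (simp add: divide_eq_eq)
    qed
    ultimately have "(\<lambda>n. \<Prod>k=n0..n. (x k - y k)) \<longlonglongrightarrow> (l - l) / (orbit x y u (n0 - 1) - l)"
      by (rule Lim_transform_eventually)
    then show ?thesis by simp
  qed
  consider "orbit x y 1 (n0 - 1) \<noteq> p" | "orbit x y 0 (n0 - 1) \<noteq> r" | "p \<noteq> r"
    | "orbit x y 1 (n0 - 1) = p" "orbit x y 0 (n0 - 1) = p" by blast
  then have "(\<lambda>n. \<Prod>k=n0..n. (x k - y k)) \<longlonglongrightarrow> 0 \<or> (\<lambda>n. (x n, y n)) \<longlonglongrightarrow> (1, 0) \<or>
      rows_colinear_to (right_product S (n0 - 1)) L"
  proof cases
    case 1
    then show ?thesis using prod_0[OF p fix_p] by blast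
  next
    case 2
    then show ?thesis using prod_0[OF r fix_r] by blast
  next
    case 3
    have "x n - y n = 1" if "n \<ge> n0" for n
    proof -
      have "(p - r) * (x n - y n) = p - r"
        using fix_p[OF that] fix_r[OF that] by (simp add: algebra_simps)
      with 3 show ?thesis by simp
    qed
    then have "(\<lambda>n. x n - y n) \<longlonglongrightarrow> 1"
      by (intro tendsto_eventually) (auto simp: eventually_sequentially)
    then show ?thesis by (simp add: factor_tendsto_1_iff)
  next
    case 4
    have "L $ 1 + L $ 2 = 1" by (simp add: L_def)
    from rows_colinear_two_state_iff[OF this] 4 show ?thesis
      by (simp add: right_product_eq) (simp add: L_def)
  qed
  with n0(1) L show ?thesis by blast
qed

text \<open>When the entry sum of \<open>L\<close> is nonzero, \<open>L\<close> can be normalized to a stationary row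
\<open>(l, 1 - l)\<close>, and each alternative makes the deviation from \<open>l\<close> converge: in the first
two the product of determinants converges, in the third the deviation vanishes at \<open>n0 - 1\<close>.
When the entry sum is $0$, the vector \<open>L\<close> is a multiple of $(1, -1)$, which every stochastic
matrix multiplies by its determinant; the determinant is then $1$ and the matrix is the identity.\<close>

lemma convergent_right_product_if_common_eigenvector:
  assumes "n0 \<ge> 1" and L: "\<forall>n\<ge>n0. left_eigenvector_1 L (S n)"
    and alt: "(\<lambda>n. \<Prod>k=n0..n. (x k - y k)) \<longlonglongrightarrow> 0 \<or> (\<lambda>n. (x n, y n)) \<longlonglongrightarrow> (1, 0) \<or>
      rows_colinear_to (right_product S (n0 - 1)) L"
  shows "convergent (right_product S)"
proof -
  have eq: "L $ 1 * (1 - x n) = L $ 2 * y n" and nz: "L \<noteq> 0" if "n \<ge> n0" for n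
    using L that \<open>n0 \<ge> 1\<close> by (simp_all add: S_eq left_eigenvector_two_state_iff)
  have orbit_conv: "convergent (orbit x y u)"
    if stat: "\<And>n. n \<ge> n0 \<Longrightarrow> y n + l * (x n - y n) = l"
      and conv: "convergent (\<lambda>n. (\<Prod>k=n0..n. (x k - y k)) * (orbit x y u (n0 - 1) - l))" for u l
  proof -
    have "convergent (\<lambda>n. (\<Prod>k=n0..n. (x k - y k)) * (orbit x y u (n0 - 1) - l) + l)"
      using conv convergent_const by (rule convergent_add)
    moreover have solved: "\<forall>\<^sub>F n in sequentially.
        (\<Prod>k=n0..n. (x k - y k)) * (orbit x y u (n0 - 1) - l) + l = orbit x y u n"
      using eventually_ge_at_top[of n0]
    proof eventually_elim
      case (elim n)
      then have "orbit x y u n - l = (\<Prod>k=n0..n. (x k - y k)) * (orbit x y u (n0 - 1) - l)"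
        using \<open>n0 \<ge> 1\<close> by (intro orbit_minus_stationary stat) auto
      then show ?case by simp
    qed
    ultimately show ?thesis by (simp only: convergent_cong[OF solved])
  qed
  have "convergent (orbit x y u)" if u: "u = 0 \<or> u = 1" for u
  proof (cases "L $ 1 + L $ 2 = 0")
    case True
    have "L $ 1 \<noteq> 0" using nz[of n0] True by (auto simp: vec_eq_iff forall_2)
    have "x n = 1 \<and> y n = 0" if "n \<ge> n0" for n
    proof -
      have "L $ 1 * (1 - x n + y n) = 0"
        using eq[OF that] True by algebra
      then have "1 - x n + y n = 0" using \<open>L $ 1 \<noteq> 0\<close> by simp
      then show ?thesis using range[of n] that \<open>n0 \<ge> 1\<close> by auto
    qed
    \<comment> \<open>Every row is stationary for the identity, in particular the one reached at \<open>n0 - 1\<close>.\<close>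
    then have "y n + orbit x y u (n0 - 1) * (x n - y n) = orbit x y u (n0 - 1)" if "n \<ge> n0" for n
      using that by simp
    then show ?thesis by (rule orbit_conv) (simp_all add: convergent_const)
  next
    case False
    define l where "l = L $ 1 / (L $ 1 + L $ 2)"
    have stat: "y n + l * (x n - y n) = l" if "n \<ge> n0" for n
      using eq[OF that] False by (simp add: l_def field_simps)
    from alt have "convergent (\<lambda>n. \<Prod>k=n0..n. (x k - y k)) \<or> orbit x y u (n0 - 1) = l"
    proof (elim disjE)
      assume "(\<lambda>n. (x n, y n)) \<longlonglongrightarrow> (1, 0)"
      then have "(\<lambda>n. x n - y n) \<longlonglongrightarrow> 1" by (simp add: factor_tendsto_1_iff)
      moreover have "x n - y n \<le> 1" if "n \<ge> n0" for n
        using range[of n] that \<open>n0 \<ge> 1\<close> by auto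
      ultimately show ?thesis by (intro disjI1 convergent_prod_if_tendsto_1)
    next
      assume "rows_colinear_to (right_product S (n0 - 1)) L"
      then show ?thesis
        using u by (auto simp: right_product_eq l_def rows_colinear_two_state_iff[OF refl False])
    qed (auto simp: convergent_def)
    then have "convergent (\<lambda>n. (\<Prod>k=n0..n. (x k - y k)) * (orbit x y u (n0 - 1) - l))"
    proof
      assume "convergent (\<lambda>n. \<Prod>k=n0..n. (x k - y k))"
      then show ?thesis using convergent_const by (rule convergent_mult)
    qed (simp add: convergent_const)
    with stat show ?thesis by (rule orbit_conv)
  qed
  then show ?thesis unfolding convergent_right_product_iff_entries by blast
qed

text \<open>The vectors $(1 - x_m, y_m)$ and $(1 - x_n, y_n)$ are both orthogonal to the nonzero vector
$(L_1, -L_2)$, so their determinant vanishes, and that determinant is, up to sign, every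
entry of the commutator.\<close>

lemma commute_if_common_eigenvector:
  assumes "left_eigenvector_1 L (S m)" "left_eigenvector_1 L (S n)" "m \<ge> 1" "n \<ge> 1"
  shows "S m ** S n = S n ** S m"
proof -
  have m: "L $ 1 * (1 - x m) = L $ 2 * y m" and n: "L $ 1 * (1 - x n) = L $ 2 * y n"
    and nz: "L $ 1 \<noteq> 0 \<or> L $ 2 \<noteq> 0"
    using assms by (auto simp: S_eq left_eigenvector_two_state_iff vec_eq_iff forall_2)
  have "L $ 1 * ((1 - x m) * y n) = L $ 1 * ((1 - x n) * y m)"
    using m n by algebra
  moreover have "L $ 2 * ((1 - x m) * y n) = L $ 2 * ((1 - x n) * y m)"
    using m n by algebra
  ultimately have "(1 - x m) * y n = (1 - x n) * y m" using nz by auto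
  then show ?thesis using assms(3,4) by (simp add: S_eq two_state_mult algebra_simps)
qed

end

section \<open>Commuting factors and the convergence criteria\<close>

lemma right_product_eq_left_product_if_commute:
  fixes S :: "nat \<Rightarrow> real^'n^'n"
  assumes comm: "\<And>m n. m \<ge> 1 \<Longrightarrow> n \<ge> 1 \<Longrightarrow> S m ** S n = S n ** S m"
  shows "right_product S n = left_product S n"
proof (induction n)
  case (Suc n)
  have "M ** left_product S k = left_product S k ** M"
    if "\<And>j. j \<ge> 1 \<Longrightarrow> S j ** M = M ** S j" for M k
  proof (induction k)
    case (Suc k)
    have "M ** left_product S (Suc k) = (S (Suc k) ** M) ** left_product S k"
      using that[of "Suc k"] by (simp add: matrix_mul_assoc)
    also have "\<dots> = S (Suc k) ** (left_product S k ** M)"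
      by (simp add: Suc.IH flip: matrix_mul_assoc)
    finally show ?case by (simp add: matrix_mul_assoc)
  qed simp
  from this[of "S (Suc n)" n] comm Suc.IH show ?case by simp
qed simp

theorem proposition1p2:
  fixes S :: "nat \<Rightarrow> real^2^2" and x y :: "nat \<Rightarrow> real"
  assumes "\<And>n. n \<ge> 1 \<Longrightarrow> stochastic (S n)"
    and "\<And>n. n \<ge> 1 \<Longrightarrow> S n = vector [vector [x n, 1 - x n], vector [y n, 1 - y n]]"
    and "\<And>n. n \<ge> 1 \<Longrightarrow> x n \<in> {0..1} \<and> y n \<in> {0..1}"
  shows
    "(convergent (left_product S) \<longleftrightarrow>
        (\<lambda>n. \<Prod>k=1..n. (x k - y k)) \<longlonglongrightarrow> 0 \<or> (\<lambda>n. (x n, y n)) \<longlonglongrightarrow> (1, 0))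
     \<and>
     (\<not> convergent (left_product S) \<longrightarrow>
        summable (\<lambda>n. 1 - \<bar>x (Suc n) - y (Suc n)\<bar>) \<and>
        \<not> S \<longlonglongrightarrow> vector [vector [1, 0], vector [0, 1]])
     \<and>
     (convergent (left_product S) \<longrightarrow>
        (\<exists>s q. (\<lambda>n. y (Suc n) * det (left_product S n)) sums s \<and>
               (\<lambda>n. det (left_product S n)) \<longlonglongrightarrow> q \<and>
               left_product S \<longlonglongrightarrow> vector [vector [s + q, 1 - s - q], vector [s, 1 - s]]))
     \<and>
     (finite (S ` {1..}) \<longrightarrow>
        (convergent (right_product S) \<longleftrightarrow>
          (\<exists>n0\<ge>1. \<exists>L. (\<forall>n\<ge>n0. left_eigenvector_1 L (S n)) \<and>
             ((\<lambda>n. \<Prod>k=n0..n. (x k - y k)) \<longlonglongrightarrow> 0 \<or>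
              (\<lambda>n. (x n, y n)) \<longlonglongrightarrow> (1, 0) \<or>
              rows_colinear_to (right_product S (n0 - 1)) L))))
     \<and>
     ((\<exists>L. \<forall>n\<ge>1. left_eigenvector_1 L (S n)) \<longrightarrow>
        (\<forall>m\<ge>1. \<forall>n\<ge>1. S m ** S n = S n ** S m) \<and>
        (\<forall>n. right_product S n = left_product S n))"
proof -
  interpret two_state_sequence S x y
    using assms by unfold_locales (auto simp: two_state_def)
  have limit_form: "two_state (s + q) s = vector [vector [s + q, 1 - s - q], vector [s, 1 - s]]" for s q
    by (simp add: two_state_def algebra_simps)
  have identity_form: "two_state 1 0 = vector [vector [1, 0], vector [0, 1]]"
    by (simp add: two_state_def)
  show ?thesis
  proof (intro conjI)
    show "convergent (left_product S) \<longleftrightarrow>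
        (\<lambda>n. \<Prod>k=1..n. (x k - y k)) \<longlonglongrightarrow> 0 \<or> (\<lambda>n. (x n, y n)) \<longlonglongrightarrow> (1, 0)"
      using convergent_left_product_iff unfolding D_def[abs_def] .
    show "\<not> convergent (left_product S) \<longrightarrow>
        summable (\<lambda>n. 1 - \<bar>x (Suc n) - y (Suc n)\<bar>) \<and>
        \<not> S \<longlonglongrightarrow> vector [vector [1, 0], vector [0, 1]]"
      using left_product_diverges unfolding identity_form by blast
    show "convergent (left_product S) \<longrightarrow>
        (\<exists>s q. (\<lambda>n. y (Suc n) * det (left_product S n)) sums s \<and>
               (\<lambda>n. det (left_product S n)) \<longlonglongrightarrow> q \<and>
               left_product S \<longlonglongrightarrow> vector [vector [s + q, 1 - s - q], vector [s, 1 - s]])"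
      using left_product_limit unfolding limit_form by blast
    show "finite (S ` {1..}) \<longrightarrow>
        (convergent (right_product S) \<longleftrightarrow>
          (\<exists>n0\<ge>1. \<exists>L. (\<forall>n\<ge>n0. left_eigenvector_1 L (S n)) \<and>
             ((\<lambda>n. \<Prod>k=n0..n. (x k - y k)) \<longlonglongrightarrow> 0 \<or>
              (\<lambda>n. (x n, y n)) \<longlonglongrightarrow> (1, 0) \<or>
              rows_colinear_to (right_product S (n0 - 1)) L)))"
      by (intro impI iffI; (elim exE conjE)?)
        (rule common_eigenvector_if_convergent_right_product
          convergent_right_product_if_common_eigenvector, assumption+)+
    show "(\<exists>L. \<forall>n\<ge>1. left_eigenvector_1 L (S n)) \<longrightarrow>
        (\<forall>m\<ge>1. \<forall>n\<ge>1. S m ** S n = S n ** S m) \<and>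
        (\<forall>n. right_product S n = left_product S n)"
    proof
      assume "\<exists>L. \<forall>n\<ge>1. left_eigenvector_1 L (S n)"
      then have comm: "S m ** S n = S n ** S m" if "m \<ge> 1" "n \<ge> 1" for m n
        using commute_if_common_eigenvector that by blast
      have "right_product S n = left_product S n" for n
        using comm by (rule right_product_eq_left_product_if_commute)
      with comm show "(\<forall>m\<ge>1. \<forall>n\<ge>1. S m ** S n = S n ** S m) \<and>
          (\<forall>n. right_product S n = left_product S n)" by blast
    qed
  qed
qed

end
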